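(* Let $\sigma_s>0$, a symmetric matrix $\Lambda$ and weights $r_1,r_2$ be given. Suppose that Assumption 1 of the context holds and that the LMIs (A1), (A2), (B) and (C$_t$) of the context are feasible with a solution $(\sigma,\lambda,\beta,\gamma,Q,L)$ at time $t=t_0\ge0$. Then, for the moving horizon closed loop described in the context, feasibility of the optimization problem $\mathcal P_t$ is guaranteed at every time $t=t_0+n$, $n\ge0$, for some $\eta\ge0$.
   Context: **System.** The true discrete-time linear time-invariant system is $$x(t+1)=A_\nu x(t)+B_\nu u(t)+E_\nu w(t),\quad y_1(t)=C_1x(t)+D_1u(t)+E_1w(t),\quad y_2(t)=C_2x(t)+D_2u(t),$$ with $x\in\mathbb R^p$, $u\in\mathbb R^q$, $w\in\mathbb R^l$, $y_1\in\mathbb R^{q_1}$, $y_2\in\mathbb R^{q_2}$. The matrices $A_\nu,B_\nu,E_\nu$ are unknown; $C_1,C_2,D_1,D_2,E_1$ are known. Standing assumptions: $(A_\nu,B_\nu)$ is stabilizable and $(C_1,A_\nu)$ is observable. Bounds $y_{2m,\max}$, $m=1,\dots,q_2$, are given. **Data.** $\hat X=[x(0)\ \cdots\ x(T)]$, $\hat U=[u(0)\ \cdots\ u(T-1)]$, $\hat W=[w(0)\ \cdots\ w(T-1)]$, $\hat X_-=[x(0)\ \cdots\ x(T-1)]$, $\hat X_+=[x(1)\ \cdots\ x(T)]$ are sampled offline from the true system, so $\hat X_+=A_\nu\hat X_-+B_\nu\hat U+E_\nu\hat W$. **Assumption 1.** The disturbance samples satisfy $\sum_{t=0}^{T-1}\|w(t)\|^2\le\alpha$,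 with $\|w(t)\|^2\le\alpha_t$ for given scalars $\alpha_t\ge0$; the disturbance is energy-bounded, i.e. as $T\to\infty$, $w\in L_2[0,\infty)$ (square summable with overall bound $\alpha\ge0$). **LMIs.** Variables are $\sigma,\lambda,\beta,\gamma^2\in\mathbb R$, $Q=Q^T>0$ in $\mathbb R^{p\times p}$, $L\in\mathbb R^{q\times p}$; $C_L:=C_1Q+D_1L$; $\ast$ denotes symmetric entries. (A1) With $D:=[\hat X_+^T\ \ -\hat X_-^T\ \ -\hat U^T\ \ -\hat W^T\ \ 0\ \ 0\ \ 0]^T$ (block row sizes $p,p,q,l,p,l,q_1$), $$\begin{bmatrix}Q-\beta I&0&0&0&0&0&0\\ \ast&0&0&0&Q&0&0\\ \ast&\ast&0&0&L&0&0\\ \ast&\ast&\ast&0&0&I&0\\ \ast&\ast&\ast&\ast&Q&-C_L^TE_1&C_L^T\\ \ast&\ast&\ast&\ast&\ast&\gamma^2I-E_1^TE_1&0\\ \ast&\ast&\ast&\ast&\ast&\ast&I\end{bmatrix}+\lambda DD^T\ge0.$$ (A2) $\begin{bmatrix}Q&-C_L^TE_1&C_L^T\\ \ast&\gamma^2I-E_1^TE_1&0\\ \ast&\ast&I\end{bmatrix}>0.$ (B) $\begin{bmatrix}\frac1{\sigma_s}\Lambda&C_2Q+D_2L\\ (C_2Q+D_2L)^T&Q\end{bmatrix}\ge0$ and $\Lambda_{ii}\le y_{2i,\max}^2$, $i=1,\dots,q_2$. (C$_t$) $\begin{bmatrix}\sigma&x(t)^T\\ x(t)&Q\end{bmatrix}\ge0.$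 (D$_t$) (for $t>0$) $\begin{bmatrix}x(t)^TP_{t-1}x(t)+p_0-p_{t-1}&x(t)^T\\ x(t)&Q\end{bmatrix}\ge0.$ **Problem $\mathcal P_t$.** At time $t$, with current state $x(t)$: minimize $r_1\sigma+r_2\gamma^2$ over $\sigma,\lambda,\beta,\gamma^2,L,Q$ subject to (A1), (A2), (B), (C$_t$), (D$_t$) and $\sigma\le\sigma_s(1+\eta)$, where $\eta\ge0$ is a scalar; at $t=0$ the constraint (D$_t$) is omitted. **Moving horizon closed loop.** At each time $t\ge0$, a solution $(\sigma_t,\lambda_t,\beta_t,\gamma_t,Q_t,L_t)$ of $\mathcal P_t$ is computed (increasing $\eta$ if needed), one sets $P_t=Q_t^{-1}$, $K_t=L_tQ_t^{-1}$, $p_0=x(0)^TP_0x(0)$ and, for $t>0$, $p_t=p_{t-1}-[x(t)^TP_{t-1}x(t)-x(t)^TP_tx(t)]$; then $u(t)=K_tx(t)$ is applied to the true system and $t$ is replaced by $t+1$. *)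

theory Defs
  imports "HOL-Analysis.Analysis"
begin

definition pos_semidef :: "real^'n^'n \<Rightarrow> bool" where
  "pos_semidef M \<longleftrightarrow> transpose M = M \<and> (\<forall>v. 0 \<le> v \<bullet> (M *v v))"

definition pos_def :: "real^'n^'n \<Rightarrow> bool" where
  "pos_def M \<longleftrightarrow> transpose M = M \<and> (\<forall>v. v \<noteq> 0 \<longrightarrow> 0 < v \<bullet> (M *v v))"

text \<open>Block matrices are indexed by sum types. Both operators associate to the right, and
  \<open>|||\<close> binds tighter than \<open>===\<close>, so a block matrix is written row by row.\<close>

definition hcat :: "real^'m^'r \<Rightarrow> real^'n^'r \<Rightarrow> real^('m + 'n)^'r"  (infixr \<open>|||\<close> 60) where
  "A ||| B = (\<chi> i j. case j of Inl k \<Rightarrow> A $ i $ k | Inr k \<Rightarrow> B $ i $ k)"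

definition vcat :: "real^'n^'r \<Rightarrow> real^'n^'s \<Rightarrow> real^'n^('r + 's)"  (infixr \<open>===\<close> 55) where
  "A === B = (\<chi> i j. case i of Inl k \<Rightarrow> A $ k $ j | Inr k \<Rightarrow> B $ k $ j)"

definition quad :: "real^'n^'n \<Rightarrow> real^'n \<Rightarrow> real" where
  "quad M v = v \<bullet> (M *v v)"

definition complex_matrix :: "real^'n^'m \<Rightarrow> complex^'n^'m" where
  "complex_matrix M = (\<chi> i j. complex_of_real (M $ i $ j))"

definition schur_stable :: "real^'p^'p \<Rightarrow> bool" where
  "schur_stable M \<longleftrightarrow>
     (\<forall>z v. v \<noteq> 0 \<and> complex_matrix M *v v = z *s v \<longrightarrow> cmod z < 1)"

definition stabilizable :: "real^'p^'p \<Rightarrow> real^'q^'p \<Rightarrow> bool" where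
  "stabilizable A B \<longleftrightarrow> (\<exists>K. schur_stable (A + B ** K))"

text \<open>The initial state is determined by the unforced output sequence.\<close>

definition observable :: "real^'p^'m \<Rightarrow> real^'p^'p \<Rightarrow> bool" where
  "observable C A \<longleftrightarrow>
     (\<forall>x x'. (\<forall>k. C *v (((*v) A ^^ k) x) = C *v (((*v) A ^^ k) x')) \<longrightarrow> x = x')"

text \<open>The samples \<open>f 0, \<dots>, f (T - 1)\<close> as columns, where \<open>T = CARD('t)\<close>. The column index type
  is enumerated by \<^const>\<open>to_nat_on\<close>, a bijection onto \<open>{..<T}\<close>; the choice of bijection only
  permutes columns, simultaneously in all data matrices.\<close>

definition samples :: "(nat \<Rightarrow> real^'n) \<Rightarrow> real^'t^'n" where
  "samples f = (\<chi> i j. f (to_nat_on UNIV j) $ i)"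

text \<open>\<open>wd\<close> is the disturbance during the offline experiment of length \<open>T\<close>, \<open>w\<close> the disturbance
  acting on the closed loop.\<close>

definition disturbance_bounds ::
  "nat \<Rightarrow> real \<Rightarrow> (nat \<Rightarrow> real) \<Rightarrow> (nat \<Rightarrow> real^'l) \<Rightarrow> (nat \<Rightarrow> real^'l) \<Rightarrow> bool" where
  "disturbance_bounds T \<alpha> \<alpha>t wd w \<longleftrightarrow>
     0 \<le> \<alpha> \<and> (\<forall>t. 0 \<le> \<alpha>t t) \<and>
     (\<Sum>t<T. (norm (wd t))\<^sup>2) \<le> \<alpha> \<and> (\<forall>t<T. (norm (wd t))\<^sup>2 \<le> \<alpha>t t) \<and>
     summable (\<lambda>t. (norm (w t))\<^sup>2) \<and> (\<Sum>t. (norm (w t))\<^sup>2) \<le> \<alpha>"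

record ('p::finite, 'q::finite, 'l::finite, 'q1::finite, 'q2::finite, 't::finite) design =
  C1 :: "real^'p^'q1"
  D1 :: "real^'q^'q1"
  E1 :: "real^'l^'q1"
  C2 :: "real^'p^'q2"
  D2 :: "real^'q^'q2"
  Xplus :: "real^'t^'p"
  Xminus :: "real^'t^'p"
  Udata :: "real^'t^'q"
  Wdata :: "real^'t^'l"
  sigma_s :: real
  Lam :: "real^'q2^'q2"
  y2max :: "real^'q2"
  r1 :: real
  r2 :: real

record ('p::finite, 'q::finite) decision =
  sigma :: real
  lam :: real
  beta :: real
  gam :: real
  Q :: "real^'p^'p"
  L :: "real^'p^'q"

definition CL ::
  "('p::finite, 'q::finite, 'l::finite, 'q1::finite, 'q2::finite, 't::finite) design \<Rightarrow>
     ('p, 'q) decision \<Rightarrow> real^'p^'q1" where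
  "CL S d = C1 S ** Q d + D1 S ** L d"

definition data_block ::
  "('p::finite, 'q::finite, 'l::finite, 'q1::finite, 'q2::finite, 't::finite) design \<Rightarrow>
     real^'t^('p + 'p + 'q + 'l + 'p + 'l + 'q1)" where
  "data_block S =
     (Xplus S === - Xminus S === - Udata S === - Wdata S === 0 === 0 === 0)"

definition LMI_A1 ::
  "('p::finite, 'q::finite, 'l::finite, 'q1::finite, 'q2::finite, 't::finite) design \<Rightarrow>
     ('p, 'q) decision \<Rightarrow> bool" where
  "LMI_A1 S d \<longleftrightarrow> pos_semidef
     ((Q d - mat (beta d) ||| 0 ||| 0 ||| 0 ||| 0 ||| 0 ||| 0 ===
       0 ||| 0 ||| 0 ||| 0 ||| Q d ||| 0 ||| 0 ===
       0 ||| 0 ||| 0 ||| 0 ||| L d ||| 0 ||| 0 ===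
       0 ||| 0 ||| 0 ||| 0 ||| 0 ||| mat 1 ||| 0 ===
       0 ||| transpose (Q d) ||| transpose (L d) ||| 0
         ||| Q d ||| - (transpose (CL S d) ** E1 S) ||| transpose (CL S d) ===
       0 ||| 0 ||| 0 ||| mat 1
         ||| - (transpose (E1 S) ** CL S d) ||| mat ((gam d)\<^sup>2) - transpose (E1 S) ** E1 S ||| 0 ===
       0 ||| 0 ||| 0 ||| 0 ||| CL S d ||| 0 ||| mat 1)
      + lam d *\<^sub>R (data_block S ** transpose (data_block S)))"

definition LMI_A2 ::
  "('p::finite, 'q::finite, 'l::finite, 'q1::finite, 'q2::finite, 't::finite) design \<Rightarrow>
     ('p, 'q) decision \<Rightarrow> bool" where
  "LMI_A2 S d \<longleftrightarrow> pos_def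
     (Q d ||| - (transpose (CL S d) ** E1 S) ||| transpose (CL S d) ===
      - (transpose (E1 S) ** CL S d) ||| mat ((gam d)\<^sup>2) - transpose (E1 S) ** E1 S ||| 0 ===
      CL S d ||| 0 ||| mat 1)"

definition LMI_B ::
  "('p::finite, 'q::finite, 'l::finite, 'q1::finite, 'q2::finite, 't::finite) design \<Rightarrow>
     ('p, 'q) decision \<Rightarrow> bool" where
  "LMI_B S d \<longleftrightarrow> pos_semidef
     ((1 / sigma_s S) *\<^sub>R Lam S ||| C2 S ** Q d + D2 S ** L d ===
      transpose (C2 S ** Q d + D2 S ** L d) ||| Q d)
   \<and> (\<forall>i. Lam S $ i $ i \<le> (y2max S $ i)\<^sup>2)"

definition bordered :: "real \<Rightarrow> real^'p \<Rightarrow> real^'p^'p \<Rightarrow> real^(1 + 'p)^(1 + 'p)" where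
  "bordered s v M = (mat s ||| rowvector v === columnvector v ||| M)"

definition LMI_C :: "real^'p \<Rightarrow> ('p, 'q::finite) decision \<Rightarrow> bool" where
  "LMI_C xt d \<longleftrightarrow> pos_semidef (bordered (sigma d) xt (Q d))"

definition Pmat :: "('p::finite, 'q::finite) decision \<Rightarrow> real^'p^'p" where
  "Pmat d = matrix_inv (Q d)"

definition Kmat :: "('p::finite, 'q::finite) decision \<Rightarrow> real^'p^'q" where
  "Kmat d = L d ** matrix_inv (Q d)"

text \<open>The scalars \<open>p\<^sub>t\<close>; \<open>s t\<close> is the solution computed at time \<open>t\<close> and \<open>x t\<close> the state.\<close>

primrec pseq :: "(nat \<Rightarrow> real^'p) \<Rightarrow> (nat \<Rightarrow> ('p, 'q::finite) decision) \<Rightarrow> nat \<Rightarrow> real" where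
  "pseq x s 0 = quad (Pmat (s 0)) (x 0)"
| "pseq x s (Suc t) =
     pseq x s t - (quad (Pmat (s t)) (x (Suc t)) - quad (Pmat (s (Suc t))) (x (Suc t)))"

definition LMI_D ::
  "(nat \<Rightarrow> real^'p) \<Rightarrow> (nat \<Rightarrow> ('p, 'q::finite) decision) \<Rightarrow> nat \<Rightarrow> ('p, 'q) decision \<Rightarrow> bool" where
  "LMI_D x s t d \<longleftrightarrow> pos_semidef
     (bordered (quad (Pmat (s (t - 1))) (x t) + pseq x s 0 - pseq x s (t - 1)) (x t) (Q d))"

text \<open>Of the history \<open>x\<close>, \<open>s\<close>, the problem at time \<open>t\<close> uses \<open>x 0, \<dots>, x t\<close> and
  \<open>s 0, \<dots>, s (t - 1)\<close> only.\<close>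

definition feasible ::
  "('p::finite, 'q::finite, 'l::finite, 'q1::finite, 'q2::finite, 't::finite) design \<Rightarrow>
     real \<Rightarrow> (nat \<Rightarrow> real^'p) \<Rightarrow> (nat \<Rightarrow> ('p, 'q) decision)
     \<Rightarrow> nat \<Rightarrow> ('p, 'q) decision \<Rightarrow> bool" where
  "feasible S \<eta> x s t d \<longleftrightarrow>
     pos_def (Q d) \<and> LMI_A1 S d \<and> LMI_A2 S d \<and> LMI_B S d \<and> LMI_C (x t) d \<and>
     (0 < t \<longrightarrow> LMI_D x s t d) \<and> sigma d \<le> sigma_s S * (1 + \<eta>)"

definition objective ::
  "('p::finite, 'q::finite, 'l::finite, 'q1::finite, 'q2::finite, 't::finite) design \<Rightarrow>
     ('p, 'q) decision \<Rightarrow> real" where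
  "objective S d = r1 S * sigma d + r2 S * (gam d)\<^sup>2"

definition optimal ::
  "('p::finite, 'q::finite, 'l::finite, 'q1::finite, 'q2::finite, 't::finite) design \<Rightarrow>
     real \<Rightarrow> (nat \<Rightarrow> real^'p) \<Rightarrow> (nat \<Rightarrow> ('p, 'q) decision)
     \<Rightarrow> nat \<Rightarrow> ('p, 'q) decision \<Rightarrow> bool" where
  "optimal S \<eta> x s t d \<longleftrightarrow>
     feasible S \<eta> x s t d \<and> (\<forall>d'. feasible S \<eta> x s t d' \<longrightarrow> objective S d \<le> objective S d')"

text \<open>The closed loop has been run at times \<open>0, \<dots>, N - 1\<close>, which produces the state \<open>x N\<close>.
  Nothing is required of the problem at time \<open>N\<close>.\<close>

definition closed_loop ::
  "('p::finite, 'q::finite, 'l::finite, 'q1::finite, 'q2::finite, 't::finite) design \<Rightarrow>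
     real^'p^'p \<Rightarrow> real^'q^'p \<Rightarrow> real^'l^'p
     \<Rightarrow> (nat \<Rightarrow> real^'l) \<Rightarrow> (nat \<Rightarrow> real^'p) \<Rightarrow> (nat \<Rightarrow> real^'q)
     \<Rightarrow> (nat \<Rightarrow> real^'q1) \<Rightarrow> (nat \<Rightarrow> real^'q2) \<Rightarrow> (nat \<Rightarrow> ('p, 'q) decision) \<Rightarrow> nat \<Rightarrow> bool" where
  "closed_loop S A B E w x u y1 y2 s N \<longleftrightarrow>
     (\<forall>t<N. (\<exists>\<eta>\<ge>0. optimal S \<eta> x s t (s t)) \<and>
        u t = Kmat (s t) *v x t \<and>
        x (Suc t) = A *v x t + B *v u t + E *v w t \<and>
        y1 t = C1 S *v x t + D1 S *v u t + E1 S *v w t \<and>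
        y2 t = C2 S *v x t + D2 S *v u t)"

end

theory Submission
  imports Defs
begin

text \<open>Three facts make the problem recursively feasible.

  First, by Schur complementation (\<open>pos_semidef_bordered_iff\<close>), the two state-dependent
  constraints are scalar ones: writing \<open>P = Q\<^sup>-\<^sup>1\<close>, (C) at time \<open>t\<close> says \<open>x\<^sub>t\<^sup>T P x\<^sub>t \<le> \<sigma>\<close>, and (D)
  says \<open>x\<^sub>t\<^sup>T P x\<^sub>t \<le> x\<^sub>t\<^sup>T P\<^sub>t\<^sub>-\<^sub>1 x\<^sub>t + p\<^sub>0 - p\<^sub>t\<^sub>-\<^sub>1\<close>.

  Second, (D) is exactly the requirement that the update of the scalars gives \<open>p\<^sub>t \<le> p\<^sub>0\<close>
  (\<open>pseq_le_pseq_0\<close>). Hence at time \<open>t\<close> the previous choice \<open>Q\<^sub>t\<^sub>-\<^sub>1\<close> satisfies (D) with slack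
  \<open>p\<^sub>0 - p\<^sub>t\<^sub>-\<^sub>1 \<ge> 0\<close>, wherever the disturbance has moved the state.

  Third, the variable \<open>\<sigma>\<close> occurs only in (C) and in the bound \<open>\<sigma> \<le> \<sigma>\<^sub>s (1 + \<eta>)\<close>. As
  \<open>\<sigma>\<^sub>s > 0\<close>, a solution of the other constraints becomes feasible for some \<open>\<eta>\<close> once \<open>\<sigma>\<close> is
  set to \<open>x\<^sub>t\<^sup>T P x\<^sub>t\<close> (\<open>feasible_for_some_eta\<close>).

  So the solution of time \<open>t - 1\<close>, with \<open>\<sigma>\<close> readjusted, is a candidate at time \<open>t\<close>. The assumed
  solution of the LMIs is what starts the argument at time \<open>0\<close>, where there is no predecessor.\<close>

lemma sum_UNIV_Plus:
  fixes f :: "'a::finite + 'b::finite \<Rightarrow> 'c::comm_monoid_add"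
  shows "sum f UNIV = (\<Sum>i\<in>UNIV. f (Inl i)) + (\<Sum>j\<in>UNIV. f (Inr j))"
  unfolding UNIV_Plus_UNIV [symmetric] by (subst sum.Plus) simp_all

lemma transpose_bordered: "transpose (bordered s b M) = bordered s b (transpose M)"
  by (simp add: vec_eq_iff transpose_def bordered_def hcat_def vcat_def mat_def
      rowvector_def columnvector_def split: sum.split)

lemma quad_bordered:
  fixes v :: "real^(1 + 'p::finite)"
  defines "a \<equiv> v $ Inl 1" and "y \<equiv> (\<chi> k. v $ Inr k)"
  shows "v \<bullet> (bordered s b M *v v) = s * a\<^sup>2 + 2 * a * (b \<bullet> y) + y \<bullet> (M *v y)"
  by (simp add: a_def y_def inner_vec_def matrix_vector_mult_def bordered_def hcat_def vcat_def
      mat_def rowvector_def columnvector_def sum_UNIV_Plus sum.distrib sum_distrib_left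
      algebra_simps power2_eq_square)

lemma pos_def_matrix_inv_right:
  fixes M :: "real^'p^'p"
  assumes "pos_def M"
  shows "M *v (matrix_inv M *v v) = v"
proof -
  have "y = 0" if "M *v y = 0" for y
    using assms that by (force simp: pos_def_def)
  then obtain N where "N ** M = mat 1"
    using matrix_left_invertible_ker [of M] by auto
  then have "\<exists>N. M ** N = mat 1 \<and> N ** M = mat 1"
    using matrix_left_right_inverse by auto
  then have "M ** matrix_inv M = mat 1 \<and> matrix_inv M ** M = mat 1"
    unfolding matrix_inv_def by (rule someI_ex)
  then show ?thesis
    by (simp add: matrix_vector_mul_assoc)
qed

text \<open>With \<open>c = M\<^sup>-\<^sup>1 b\<close>, the form of the bordered matrix at \<open>(a, y)\<close> is the sum of
  \<open>(y + a c)\<^sup>T M (y + a c)\<close> and \<open>(s - b\<^sup>T c) a\<^sup>2\<close>, so its sign depends on \<open>s - b\<^sup>T c\<close> alone.\<close>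

lemma pos_semidef_bordered_iff:
  fixes M :: "real^'p^'p"
  assumes "pos_def M"
  shows "pos_semidef (bordered s b M) \<longleftrightarrow> quad (matrix_inv M) b \<le> s"
proof
  define c where "c = matrix_inv M *v b"
  have Mc: "M *v c = b"
    using assms by (simp add: c_def pos_def_matrix_inv_right)
  have sym: "transpose M = M"
    using assms by (simp add: pos_def_def)
  {
    assume psd: "pos_semidef (bordered s b M)"
    \<comment> \<open>Given the first coordinate \<open>1\<close>, the form is least at the remaining coordinates \<open>- c\<close>.\<close>
    define v :: "real^(1 + 'p)" where "v = (\<chi> i. case i of Inl _ \<Rightarrow> 1 | Inr k \<Rightarrow> - (c $ k))"
    have "(\<chi> k. v $ Inr k) = - c" and "v $ Inl 1 = 1"
      by (simp_all add: v_def vec_eq_iff)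
    then have "v \<bullet> (bordered s b M *v v) = s - b \<bullet> c"
      by (simp add: quad_bordered Mc linear_neg [OF matrix_vector_mul_linear] inner_commute)
    moreover have "0 \<le> v \<bullet> (bordered s b M *v v)"
      using psd by (simp add: pos_semidef_def)
    ultimately show "quad (matrix_inv M) b \<le> s"
      by (simp add: quad_def c_def)
  }
  {
    assume le: "quad (matrix_inv M) b \<le> s"
    have "0 \<le> v \<bullet> (bordered s b M *v v)" for v
    proof -
      define a where "a = v $ Inl 1"
      define y where "y = (\<chi> k. v $ Inr k)"
      define z where "z = y + a *\<^sub>R c"
      have swap: "c \<bullet> (M *v y) = b \<bullet> y"
        by (metis Mc dot_lmul_matrix sym transpose_matrix_vector)
      have "0 \<le> z \<bullet> (M *v z)"
        using assms by (cases "z = 0") (auto simp: pos_def_def less_imp_le)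
      \<comment> \<open>Completing the square.\<close>
      also have "z \<bullet> (M *v z) = y \<bullet> (M *v y) + 2 * a * (b \<bullet> y) + (b \<bullet> c) * a\<^sup>2"
        by (simp add: z_def matrix_vector_right_distrib matrix_vector_mult_scaleR Mc swap
            inner_add_left inner_add_right inner_commute power2_eq_square algebra_simps)
      also have "\<dots> \<le> y \<bullet> (M *v y) + 2 * a * (b \<bullet> y) + s * a\<^sup>2"
        using le by (simp add: quad_def c_def mult_right_mono)
      finally show ?thesis
        unfolding quad_bordered a_def [symmetric] y_def [symmetric] by linarith
    qed
    then show "pos_semidef (bordered s b M)"
      by (simp add: pos_semidef_def transpose_bordered sym)
  }
qed

lemma LMI_D_iff:
  assumes "pos_def (Q d)"
  shows "LMI_D x s t d \<longleftrightarrow>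
    quad (Pmat d) (x t) \<le> quad (Pmat (s (t - 1))) (x t) + pseq x s 0 - pseq x s (t - 1)"
  unfolding LMI_D_def Pmat_def using assms by (rule pos_semidef_bordered_iff)

text \<open>(D) bounds each scalar by \<open>p\<^sub>0\<close> directly rather than by its predecessor, because \<open>p\<^sub>t\<^sub>-\<^sub>1\<close> cancels
  between (D) and the update rule.\<close>

lemma pseq_le_pseq_0:
  assumes "feasible S \<eta> x s t (s t)"
  shows "pseq x s t \<le> pseq x s 0"
proof (cases t)
  case (Suc k)
  then have "pos_def (Q (s t))" and "LMI_D x s t (s t)"
    using assms by (simp_all add: feasible_def)
  then show ?thesis
    using Suc by (simp add: LMI_D_iff)
qed simp

lemma feasible_for_some_eta:
  fixes d :: "('p::finite, 'q::finite) decision"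
  assumes "0 < sigma_s S"
    and "pos_def (Q d)" and "LMI_A1 S d" and "LMI_A2 S d" and "LMI_B S d"
    and "0 < t \<Longrightarrow> LMI_D x s t d"
  shows "\<exists>\<eta>\<ge>0. \<exists>d'. feasible S \<eta> x s t d'"
proof -
  define c where "c = quad (matrix_inv (Q d)) (x t)"
  define \<eta> where "\<eta> = \<bar>c\<bar> / sigma_s S"
  have "c \<le> sigma_s S * (1 + \<eta>)"
    using assms(1) by (simp add: \<eta>_def distrib_left)
  moreover have "LMI_C (x t) (d\<lparr>sigma := c\<rparr>)"
    using assms(2) by (simp add: LMI_C_def pos_semidef_bordered_iff c_def)
  moreover have "LMI_A1 S (d\<lparr>sigma := c\<rparr>)" "LMI_A2 S (d\<lparr>sigma := c\<rparr>)" "LMI_B S (d\<lparr>sigma := c\<rparr>)"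
    using assms(3-5) by (simp_all add: LMI_A1_def LMI_A2_def LMI_B_def CL_def)
  moreover have "0 < t \<longrightarrow> LMI_D x s t (d\<lparr>sigma := c\<rparr>)"
    using assms(6) by (simp add: LMI_D_def)
  ultimately have "feasible S \<eta> x s t (d\<lparr>sigma := c\<rparr>)"
    using assms(2) by (simp add: feasible_def)
  moreover have "0 \<le> \<eta>"
    using assms(1) by (simp add: \<eta>_def)
  ultimately show ?thesis
    by blast
qed

lemma feasible_Suc:
  assumes "0 < sigma_s S" and feas: "feasible S \<eta> x s t (s t)"
  shows "\<exists>\<eta>\<ge>0. \<exists>d. feasible S \<eta> x s (Suc t) d"
proof (rule feasible_for_some_eta)
  show "LMI_D x s (Suc t) (s t)"
    using feas pseq_le_pseq_0 [OF feas] by (simp add: LMI_D_iff feasible_def)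
qed (use assms in \<open>simp_all add: feasible_def\<close>)

theorem lemma4:
  fixes S :: "('p::finite, 'q::finite, 'l::finite, 'q1::finite, 'q2::finite, 't::finite) design"
    and A :: "real^'p^'p" and B :: "real^'q^'p" and E :: "real^'l^'p"
    and xd x :: "nat \<Rightarrow> real^'p" and ud u :: "nat \<Rightarrow> real^'q" and wd w :: "nat \<Rightarrow> real^'l"
    and y1 :: "nat \<Rightarrow> real^'q1" and y2 :: "nat \<Rightarrow> real^'q2"
    and \<alpha> :: real and \<alpha>t :: "nat \<Rightarrow> real"
    and s :: "nat \<Rightarrow> ('p, 'q) decision" and d0 :: "('p, 'q) decision" and t0 :: nat
  assumes "stabilizable A B" and "observable (C1 S) A"
    and "\<forall>t<CARD('t). xd (Suc t) = A *v xd t + B *v ud t + E *v wd t"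
    and "Xplus S = samples (\<lambda>t. xd (Suc t))" and "Xminus S = samples xd"
    and "Udata S = samples ud" and "Wdata S = samples wd"
    and "disturbance_bounds CARD('t) \<alpha> \<alpha>t wd w"
    and "0 < sigma_s S" and "transpose (Lam S) = Lam S"
    and "pos_def (Q d0)" and "LMI_A1 S d0" and "LMI_A2 S d0" and "LMI_B S d0"
    and "LMI_C (x t0) d0"
  shows "\<forall>n. closed_loop S A B E w x u y1 y2 s (t0 + n) \<longrightarrow>
           (\<exists>\<eta>\<ge>0. \<exists>d. feasible S \<eta> x s (t0 + n) d)"
proof (intro allI impI)
  fix n
  assume loop: "closed_loop S A B E w x u y1 y2 s (t0 + n)"
  show "\<exists>\<eta>\<ge>0. \<exists>d. feasible S \<eta> x s (t0 + n) d"
  proof (cases "t0 + n")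
    case 0
    have "\<exists>\<eta>\<ge>0. \<exists>d. feasible S \<eta> x s 0 d"
      by (rule feasible_for_some_eta [where d = d0]) (use assms in simp_all)
    then show ?thesis
      using 0 by simp
  next
    case (Suc k)
    then obtain \<eta> where "feasible S \<eta> x s k (s k)"
      using loop by (auto simp: closed_loop_def optimal_def)
    then show ?thesis
      unfolding Suc by (rule feasible_Suc [OF \<open>0 < sigma_s S\<close>])
  qed
qed

end
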